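(* Let $\mathbf{G}(s)=\mathbf{C}(s\mathbf{I}-\mathbf{A})^{-1}\mathbf{B}$ and $\widehat{\mathbf{G}}(s)=\widehat{\mathbf{C}}(s\mathbf{I}-\widehat{\mathbf{A}})^{-1}\widehat{\mathbf{B}}$ be stabilizable and detectable, with left-coprime factorizations $\mathbf{G}=\mathbf{M}^{-1}\mathbf{N}$ and $\widehat{\mathbf{G}}=\widehat{\mathbf{M}}^{-1}\widehat{\mathbf{N}}$ and with $\mathbf{G}_{\mathbf{F}}=[\mathbf{M},\mathbf{N}]$, $\widehat{\mathbf{G}}_{\mathbf{F}}=[\widehat{\mathbf{M}},\widehat{\mathbf{N}}]$ as defined in the context. Further, let $\mathbf{G}_{\mathbf{F}}$ and $\widehat{\mathbf{G}}_{\mathbf{F}}$ have the pole-residue representations $$\mathbf{G}_{\mathbf{F}}(s)=[\mathbf{I},0]+\sum_{i=1}^n\frac{\mathbf{c}_i[\mathbf{f}_i^T,\mathbf{b}_i^T]}{s-\lambda_i},\qquad \widehat{\mathbf{G}}_{\mathbf{F}}(s)=[\mathbf{I},0]+\sum_{j=1}^r\frac{\widehat{\mathbf{c}}_j[\widehat{\mathbf{f}}_j^T,\widehat{\mathbf{b}}_j^T]}{s-\widehat{\lambda}_j}$$ given in the context. Then $$\|\mathbf{G}-\widehat{\mathbf{G}}\|_{\mathcal{H}_2\text{-gap}}^2=\sum_{i=1}^n\mathbf{c}_i^T\,\widehat{\mathbf{M}}(-\lambda_i)\left(\mathbf{G}(-\lambda_i)-\widehat{\mathbf{G}}(-\lam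bda_i)\right)\mathbf{b}_i+\sum_{j=1}^r\widehat{\mathbf{c}}_j^T\,\mathbf{M}(-\widehat{\lambda}_j)\left(\widehat{\mathbf{G}}(-\widehat{\lambda}_j)-\mathbf{G}(-\widehat{\lambda}_j)\right)\widehat{\mathbf{b}}_j.$$
   Context: $\mathbf{A}\in\mathbb{R}^{n\times n}$, $\mathbf{B}\in\mathbb{R}^{n\times m}$, $\mathbf{C}\in\mathbb{R}^{p\times n}$, $\widehat{\mathbf{A}}\in\mathbb{R}^{r\times r}$, $\widehat{\mathbf{B}}\in\mathbb{R}^{r\times m}$, $\widehat{\mathbf{C}}\in\mathbb{R}^{p\times r}$. "Stabilizable and detectable" means $(\mathbf{A},\mathbf{B})$ is stabilizable and $(\mathbf{A},\mathbf{C})$ is detectable (and likewise for the hatted system). Let $\mathbf{P}=\mathbf{P}^T\succeq 0$ be the solution of $\mathbf{A}\mathbf{P}+\mathbf{P}\mathbf{A}^T-\mathbf{P}\mathbf{C}^T\mathbf{C}\mathbf{P}+\mathbf{B}\mathbf{B}^T=0$, $\mathbf{F}=\mathbf{P}\mathbf{C}^T$, and $\mathbf{A}_{\mathbf{F}}=\mathbf{A}-\mathbf{F}\mathbf{C}$ (asymptotically stable). Set $\mathbf{M}(s)=\mathbf{I}-\mathbf{C}(s\mathbf{I}-\mathbf{A}_{\mathbf{F}})^{-1}\mathbf{F}$, $\mathbf{N}(s)=\mathbf{C}(s\mathbf{I}-\mathbf{A}_{\mathbf{F}})^{-1}\mathbf{B}$, so $\mathbf{G}=\mathbf{M}^{-1}\mathbf{N}$,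 and $\mathbf{G}_{\mathbf{F}}=[\mathbf{M},\mathbf{N}]$. The quantities $\widehat{\mathbf{P}}$, $\widehat{\mathbf{F}}=\widehat{\mathbf{P}}\widehat{\mathbf{C}}^T$, $\widehat{\mathbf{A}}_{\widehat{\mathbf{F}}}=\widehat{\mathbf{A}}-\widehat{\mathbf{F}}\widehat{\mathbf{C}}$, $\widehat{\mathbf{M}}$, $\widehat{\mathbf{N}}$, $\widehat{\mathbf{G}}_{\mathbf{F}}=[\widehat{\mathbf{M}},\widehat{\mathbf{N}}]$ are defined in the same way from $(\widehat{\mathbf{A}},\widehat{\mathbf{B}},\widehat{\mathbf{C}})$. Pole-residue data: the eigenvalues $\lambda_1,\dots,\lambda_n$ of $\mathbf{A}_{\mathbf{F}}$ are assumed semi-simple. Let $\mathbf{W}=[\mathbf{w}_1,\dots,\mathbf{w}_n]\in\mathbb{C}^{n\times n}$ be an invertible matrix of left eigenvectors, $\mathbf{w}_i^T\mathbf{A}_{\mathbf{F}}=\lambda_i\mathbf{w}_i^T$ (transpose, not conjugate transpose), and $\mathbf{V}=[\mathbf{v}_1,\dots,\mathbf{v}_n]=\mathbf{W}^{-T}$. Then $\mathbf{b}_i=\mathbf{B}^T\mathbf{w}_i$, $\mathbf{f}_i=-\mathbf{F}^T\mathbf{w}_i=-\mathbf{C}\mathbf{P}\mathbf{w}_i$, $\mathbf{c}_i=\mathbf{C}\mathbf{v}_i$. The data $\widehat{\lambda}_j$, $\widehat{\mathbf{w}}_j$, $\widehat{\mathbf{v}}_j$, $\widehat{\mathbf{b}}_j=\widehat{\mathbf{B}}^T\widehat{\mathbf{w}}_j$,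 $\widehat{\mathbf{f}}_j=-\widehat{\mathbf{F}}^T\widehat{\mathbf{w}}_j=-\widehat{\mathbf{C}}\widehat{\mathbf{P}}\widehat{\mathbf{w}}_j$, $\widehat{\mathbf{c}}_j=\widehat{\mathbf{C}}\widehat{\mathbf{v}}_j$, $j=1,\dots,r$, are defined in the same way from $\widehat{\mathbf{A}}_{\widehat{\mathbf{F}}}$, whose eigenvalues are likewise assumed semi-simple. The $\mathcal{H}_2$-gap is $\|\mathbf{G}-\widehat{\mathbf{G}}\|_{\mathcal{H}_2\text{-gap}}:=\left\|[\mathbf{M},\mathbf{N}]-[\widehat{\mathbf{M}},\widehat{\mathbf{N}}]\right\|_{\mathcal{H}_2}$, where, for a matrix-valued function $\mathbf{H}$ analytic on the open right half-plane, $\|\mathbf{H}\|_{\mathcal{H}_2}:=\left(\sup_{\sigma>0}\int_{-\infty}^{\infty}\|\mathbf{H}(\sigma+\imath\omega)\|_F^2\,d\omega\right)^{1/2}$ and $\|\cdot\|_F$ is the Frobenius norm.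
   Formalization: The squared H2 norm carries the factor 1/(2π), without which the identity is false; and the points −λ_i and −λ̂_j are assumed not to be eigenvalues of A or Â, so that G and Ĝ are defined there. *)

theory Defs
  imports "HOL-Analysis.Analysis"
begin

abbreviation cmat :: "real^'n^'m \<Rightarrow> complex^'n^'m" where
  "cmat \<equiv> map_matrix complex_of_real"

definition is_eigenvalue :: "real^'n^'n \<Rightarrow> complex \<Rightarrow> bool" where
  "is_eigenvalue A z \<longleftrightarrow> (\<exists>x. x \<noteq> 0 \<and> cmat A *v x = z *s x)"

definition asymptotically_stable :: "real^'n^'n \<Rightarrow> bool" where
  "asymptotically_stable A \<longleftrightarrow> (\<forall>z. is_eigenvalue A z \<longrightarrow> Re z < 0)"

definition stabilizable :: "real^'n^'n \<Rightarrow> real^'m^'n \<Rightarrow> bool" where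
  "stabilizable A B \<longleftrightarrow> (\<exists>K :: real^'n^'m. asymptotically_stable (A - B ** K))"

definition detectable :: "real^'n^'n \<Rightarrow> real^'n^'p \<Rightarrow> bool" where
  "detectable A C \<longleftrightarrow> (\<exists>L :: real^'p^'n. asymptotically_stable (A - L ** C))"

text \<open>The transfer function \<open>C (s I - A)\<^sup>-\<^sup>1 B\<close>.  It is meaningful only where \<open>s\<close> is not an
  eigenvalue of \<open>A\<close>; elsewhere \<^const>\<open>matrix_inv\<close> is unspecified.\<close>

definition transfer :: "real^'n^'n \<Rightarrow> real^'m^'n \<Rightarrow> real^'n^'p \<Rightarrow> complex \<Rightarrow> complex^'m^'p" where
  "transfer A B C s = cmat C ** matrix_inv (mat s - cmat A) ** cmat B"

definition pos_semidef :: "real^'n^'n \<Rightarrow> bool" where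
  "pos_semidef P \<longleftrightarrow> transpose P = P \<and> (\<forall>x. 0 \<le> x \<bullet> (P *v x))"

definition riccati_solution ::
    "real^'n^'n \<Rightarrow> real^'m^'n \<Rightarrow> real^'n^'p \<Rightarrow> real^'n^'n \<Rightarrow> bool" where
  "riccati_solution A B C P \<longleftrightarrow> pos_semidef P \<and>
     A ** P + P ** transpose A - P ** transpose C ** C ** P + B ** transpose B = 0"

definition gain :: "real^'n^'p \<Rightarrow> real^'n^'n \<Rightarrow> real^'p^'n" where
  "gain C P = P ** transpose C"

definition closed_loop :: "real^'n^'n \<Rightarrow> real^'n^'p \<Rightarrow> real^'n^'n \<Rightarrow> real^'n^'n" where
  "closed_loop A C P = A - gain C P ** C"

definition factor_M ::
    "real^'n^'n \<Rightarrow> real^'n^'p \<Rightarrow> real^'n^'n \<Rightarrow> complex \<Rightarrow> complex^'p^'p" where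
  "factor_M A C P s =
     mat 1 - cmat C ** matrix_inv (mat s - cmat (closed_loop A C P)) ** cmat (gain C P)"

definition factor_N ::
    "real^'n^'n \<Rightarrow> real^'m^'n \<Rightarrow> real^'n^'p \<Rightarrow> real^'n^'n \<Rightarrow> complex \<Rightarrow> complex^'m^'p" where
  "factor_N A B C P s =
     cmat C ** matrix_inv (mat s - cmat (closed_loop A C P)) ** cmat B"

definition hcat :: "'a^'k^'p \<Rightarrow> 'a^'m^'p \<Rightarrow> 'a^('k + 'm)^'p" where
  "hcat X Y = (\<chi> i k. case k of Inl a \<Rightarrow> X $ i $ a | Inr b \<Rightarrow> Y $ i $ b)"

definition factors_MN :: "real^'n^'n \<Rightarrow> real^'m^'n \<Rightarrow> real^'n^'p \<Rightarrow> real^'n^'n \<Rightarrow>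
    complex \<Rightarrow> complex^('p + 'm)^'p" where
  "factors_MN A B C P s = hcat (factor_M A C P s) (factor_N A B C P s)"

text \<open>The norm on \<^typ>\<open>complex^'m^'p\<close> is the Frobenius norm.  The \<open>H\<^sub>2\<close> norm carries the factor
  \<open>1/(2\<pi>)\<close>, so that \<open>s \<mapsto> 1/(s - \<mu>)\<close> has squared norm \<open>-1/(2 Re \<mu>)\<close> for \<open>Re \<mu> < 0\<close>; the pole-residue
  expression of the norm, \<open>\<Sum> tr (R\<^sub>i\<^sup>T H(-\<mu>\<^sub>i))\<close>, needs this normalisation.  The real-valued
  \<open>h2_norm\<close> is meaningful only if \<open>in_H2\<close> holds.\<close>

definition h2_energy :: "(complex \<Rightarrow> complex^'m^'p) \<Rightarrow> ennreal" where
  "h2_energy H =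
     (SUP \<sigma>\<in>{0<..}. \<integral>\<^sup>+ \<omega>. ennreal ((norm (H (Complex \<sigma> \<omega>)))\<^sup>2) \<partial>lborel)"

definition in_H2 :: "(complex \<Rightarrow> complex^'m^'p) \<Rightarrow> bool" where
  "in_H2 H \<longleftrightarrow> h2_energy H < \<infinity>"

definition h2_norm :: "(complex \<Rightarrow> complex^'m^'p) \<Rightarrow> real" where
  "h2_norm H = sqrt (enn2real (h2_energy H) / (2 * pi))"

definition h2_gap ::
    "real^'n^'n \<Rightarrow> real^'m^'n \<Rightarrow> real^'n^'p \<Rightarrow> real^'n^'n \<Rightarrow>
     real^'r^'r \<Rightarrow> real^'m^'r \<Rightarrow> real^'r^'p \<Rightarrow> real^'r^'r \<Rightarrow> real" where
  "h2_gap A B C P Ah Bh Ch Ph =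
     h2_norm (\<lambda>s. factors_MN A B C P s - factors_MN Ah Bh Ch Ph s)"

text \<open>The columns of \<open>W\<close> form a basis of left eigenvectors of \<open>A\<close> (plain transpose, no
  conjugation).  Such a \<open>W\<close> exists exactly when all eigenvalues are semi-simple, and then \<open>\<mu>\<close>
  lists them with multiplicity.\<close>

definition left_eigenbasis :: "real^'n^'n \<Rightarrow> ('n \<Rightarrow> complex) \<Rightarrow> complex^'n^'n \<Rightarrow> bool" where
  "left_eigenbasis A \<mu> W \<longleftrightarrow> invertible W \<and>
     (\<forall>i. column i W v* cmat A = \<mu> i *s column i W)"

definition res_b :: "real^'m^'n \<Rightarrow> complex^'n^'n \<Rightarrow> 'n \<Rightarrow> complex^'m" where
  "res_b B W i = transpose (cmat B) *v column i W"

definition res_f :: "real^'n^'p \<Rightarrow> real^'n^'n \<Rightarrow> complex^'n^'n \<Rightarrow> 'n \<Rightarrow> complex^'p" where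
  "res_f C P W i = - (transpose (cmat (gain C P)) *v column i W)"

definition res_c :: "real^'n^'p \<Rightarrow> complex^'n^'n \<Rightarrow> 'n \<Rightarrow> complex^'p" where
  "res_c C W i = cmat C *v column i (matrix_inv (transpose W))"

definition outer :: "'a::times^'p \<Rightarrow> 'a^'m \<Rightarrow> 'a^'m^'p" where
  "outer x y = (\<chi> i j. x $ i * y $ j)"

definition vcat :: "'a^'k \<Rightarrow> 'a^'m \<Rightarrow> 'a^('k + 'm)" where
  "vcat x y = (\<chi> k. case k of Inl a \<Rightarrow> x $ a | Inr b \<Rightarrow> y $ b)"

lemma matrix_inv_unique:
  fixes X Y :: "complex^'n^'n"
  assumes "X ** Y = mat 1"
  shows "matrix_inv X = Y"
proof -
  have YX: "Y ** X = mat 1" using assms by (simp add: matrix_left_right_inverse)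
  have "\<exists>Z. X ** Z = mat 1 \<and> Z ** X = mat 1" using assms YX by blast
  then have "matrix_inv X ** X = mat 1"
    unfolding matrix_inv_def by (rule someI2_ex) simp
  then have "matrix_inv X ** (X ** Y) = Y" by (simp add: matrix_mul_assoc)
  then show ?thesis using assms by simp
qed

lemma resolvent_eigenbasis:
  fixes A :: "real^'n^'n"
  assumes E: "left_eigenbasis A \<mu> W" and s: "\<And>i. s \<noteq> \<mu> i"
  shows "matrix_inv (mat s - cmat A) $ a $ b =
    (\<Sum>i\<in>UNIV. matrix_inv (transpose W) $ a $ i * W $ b $ i / (s - \<mu> i))"
proof -
  define V where "V = matrix_inv (transpose W)"
  define R :: "complex^'n^'n" where
    "R = (\<chi> a b. \<Sum>i\<in>UNIV. V $ a $ i * W $ b $ i / (s - \<mu> i))"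
  have ev: "\<And>i. column i W v* cmat A = \<mu> i *s column i W"
    using E by (simp add: left_eigenbasis_def)
  obtain Y where "Y ** W = mat 1"
    using E by (auto simp: left_eigenbasis_def invertible_def)
  then have "transpose (Y ** W) = mat 1" by (simp add: transpose_mat)
  then have Z: "transpose W ** transpose Y = mat 1"
    by (simp add: matrix_transpose_mul)
  have VW: "V ** transpose W = mat 1"
    using matrix_inv_unique[OF Z] Z by (simp add: V_def matrix_left_right_inverse)
  have evc: "(\<Sum>k\<in>UNIV. W $ k $ i * cmat A $ k $ b) = \<mu> i * W $ b $ i" for i b
    using arg_cong[OF ev[of i], of "\<lambda>v. v $ b"]
    by (simp add: vector_matrix_mult_def column_def mult.commute)
  have mats: "(\<Sum>k\<in>UNIV. W $ k $ i * (mat s - cmat A) $ k $ b) = (s - \<mu> i) * W $ b $ i" for i b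
  proof -
    have "(\<Sum>k\<in>UNIV. W $ k $ i * (mat s :: complex^'n^'n) $ k $ b) = s * W $ b $ i"
      by (simp add: mat_def if_distrib cong: if_cong)
    then show ?thesis
      using evc[of i b] by (simp add: algebra_simps sum_subtractf)
  qed
  have "(R ** (mat s - cmat A)) $ a $ b = (mat 1 :: complex^'n^'n) $ a $ b" for a b
  proof -
    have "(R ** (mat s - cmat A)) $ a $ b =
        (\<Sum>k\<in>UNIV. \<Sum>i\<in>UNIV. V $ a $ i / (s - \<mu> i) * (W $ k $ i * (mat s - cmat A) $ k $ b))"
      by (simp add: matrix_matrix_mult_def R_def sum_distrib_right mult.assoc)
    also have "\<dots> = (\<Sum>i\<in>UNIV. V $ a $ i / (s - \<mu> i) *
        (\<Sum>k\<in>UNIV. W $ k $ i * (mat s - cmat A) $ k $ b))"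
      by (subst sum.swap) (simp only: sum_distrib_left)
    also have "\<dots> = (\<Sum>i\<in>UNIV. V $ a $ i * W $ b $ i)"
      using s by (simp only: mats) simp
    also have "\<dots> = (V ** transpose W) $ a $ b"
      by (simp add: matrix_matrix_mult_def transpose_def)
    finally show ?thesis by (simp add: VW)
  qed
  then have "R ** (mat s - cmat A) = mat 1" by (simp add: vec_eq_iff)
  then have "matrix_inv (mat s - cmat A) = R"
    by (intro matrix_inv_unique) (simp add: matrix_left_right_inverse)
  then show ?thesis by (simp add: R_def V_def)
qed

lemma resolvent_sandwich:
  fixes A :: "real^'n^'n"
  assumes "left_eigenbasis A \<mu> W" and "\<And>i. s \<noteq> \<mu> i"
  shows "(cmat C ** matrix_inv (mat s - cmat A) ** X) $ k $ l =
    (\<Sum>i\<in>UNIV. res_c C W i $ k * (transpose X *v column i W) $ l / (s - \<mu> i))"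
proof -
  let ?V = "matrix_inv (transpose W)"
  have "(cmat C ** matrix_inv (mat s - cmat A) ** X) $ k $ l =
     (\<Sum>b\<in>UNIV. \<Sum>a\<in>UNIV. \<Sum>i\<in>UNIV.
        cmat C $ k $ a * ?V $ a $ i * (X $ b $ l * W $ b $ i) / (s - \<mu> i))"
    by (simp add: matrix_matrix_mult_def resolvent_eigenbasis[OF assms]
        sum_distrib_left sum_distrib_right mult.assoc)
      (simp add: mult_ac)
  also have "\<dots> = (\<Sum>b\<in>UNIV. \<Sum>i\<in>UNIV. \<Sum>a\<in>UNIV.
        cmat C $ k $ a * ?V $ a $ i * (X $ b $ l * W $ b $ i) / (s - \<mu> i))"
    by (intro sum.cong refl sum.swap)
  also have "\<dots> = (\<Sum>i\<in>UNIV. \<Sum>b\<in>UNIV. \<Sum>a\<in>UNIV.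
        cmat C $ k $ a * ?V $ a $ i * (X $ b $ l * W $ b $ i) / (s - \<mu> i))"
    by (rule sum.swap)
  also have "\<dots> = (\<Sum>i\<in>UNIV. res_c C W i $ k * (transpose X *v column i W) $ l / (s - \<mu> i))"
  proof (rule sum.cong[OF refl])
    fix i
    have "res_c C W i $ k * (transpose X *v column i W) $ l =
        (\<Sum>a\<in>UNIV. cmat C $ k $ a * ?V $ a $ i) * (\<Sum>b\<in>UNIV. X $ b $ l * W $ b $ i)"
      by (simp add: res_c_def matrix_vector_mult_def column_def transpose_def)
    also have "\<dots> = (\<Sum>b\<in>UNIV. \<Sum>a\<in>UNIV.
        cmat C $ k $ a * ?V $ a $ i * (X $ b $ l * W $ b $ i))"
      by (subst sum_product) (rule sum.swap)
    finally show "(\<Sum>b\<in>UNIV. \<Sum>a\<in>UNIV.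
        cmat C $ k $ a * ?V $ a $ i * (X $ b $ l * W $ b $ i) / (s - \<mu> i)) =
      res_c C W i $ k * (transpose X *v column i W) $ l / (s - \<mu> i)"
      by (simp only: sum_divide_distrib)
  qed
  finally show ?thesis .
qed

text \<open>The pole-residue representation
  \<open>[M, N](s) = [I, 0] + \<Sum>\<^sub>i c\<^sub>i [f\<^sub>i\<^sup>T, b\<^sub>i\<^sup>T] / (s - \<mu>\<^sub>i)\<close>.\<close>

lemma factors_MN_pole_residue:
  assumes E: "left_eigenbasis (closed_loop A C P) \<mu> W" and s: "\<And>i. s \<noteq> \<mu> i"
  shows "factors_MN A B C P s = hcat (mat 1) 0 +
    (\<Sum>i\<in>UNIV. map_matrix (\<lambda>z. z / (s - \<mu> i))
       (outer (res_c C W i) (vcat (res_f C P W i) (res_b B W i))))"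
proof -
  note R = resolvent_sandwich[OF E s]
  have "factors_MN A B C P s $ k $ l = (hcat (mat 1) 0 +
    (\<Sum>i\<in>UNIV. map_matrix (\<lambda>z. z / (s - \<mu> i))
       (outer (res_c C W i) (vcat (res_f C P W i) (res_b B W i))))) $ k $ l" for k l
    by (cases l) (simp_all add: factors_MN_def hcat_def vcat_def outer_def factor_M_def
        factor_N_def R res_f_def res_b_def sum_negf)
  then show ?thesis by (simp add: vec_eq_iff)
qed

end

theory Submission
  imports Defs "HOL-Real_Asymp.Real_Asymp"
begin

text \<open>
  Both closed loops are stable, so \<open>H = [M, N] - [M\<^sub>h, N\<^sub>h]\<close> is a sum of terms \<open>R\<^sub>k / (s - \<nu>\<^sub>k)\<close> with
  \<open>Re \<nu>\<^sub>k < 0\<close>.  Its energy on the line \<open>Re s = \<sigma>\<close> is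
  \<open>2 \<pi> \<Sum>\<^sub>k\<^sub>l \<langle>R\<^sub>k, R\<^sub>l\<rangle> / (2 \<sigma> - \<nu>\<^sub>k - cnj \<nu>\<^sub>l)\<close>, which decreases in \<open>\<sigma>\<close>, so the supremum is the value at
  \<open>\<sigma> = 0\<close>; as \<open>H\<close> is real this gives \<open>\<parallel>H\<parallel>\<^sup>2 = \<Sum>\<^sub>k tr (R\<^sub>k\<^sup>T H(-\<nu>\<^sub>k))\<close>.  The Riccati equation, applied to a
  left eigenvector \<open>w\<^sub>i\<close> of the closed loop, reads \<open>(-\<mu>\<^sub>i I - A) P w\<^sub>i = B b\<^sub>i\<close>; hence
  \<open>f\<^sub>i = - G(-\<mu>\<^sub>i) b\<^sub>i\<close> and \<open>M(-\<mu>\<^sub>i) f\<^sub>i + N(-\<mu>\<^sub>i) b\<^sub>i = 0\<close>, while \<open>N\<^sub>h = M\<^sub>h G\<^sub>h\<close> turns the other factor into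
  \<open>M\<^sub>h(-\<mu>\<^sub>i) (G\<^sub>h(-\<mu>\<^sub>i) - G(-\<mu>\<^sub>i)) b\<^sub>i\<close>.
\<close>

subsection \<open>Stability of the closed loop\<close>

lemma cmat_mult: "cmat (A ** B) = cmat A ** cmat B"
  by (simp add: vec_eq_iff matrix_matrix_mult_def)

lemma cmat_add: "cmat (A + B) = cmat A + cmat B"
  by (simp add: vec_eq_iff)

lemma cmat_diff: "cmat (A - B) = cmat A - cmat B"
  by (simp add: vec_eq_iff)

lemma cmat_zero: "cmat 0 = 0"
  by (simp add: vec_eq_iff)

lemma cmat_transpose: "cmat (transpose A) = transpose (cmat A)"
  by (simp add: vec_eq_iff transpose_def)

lemmas cmat_simps = cmat_mult cmat_add cmat_diff cmat_zero cmat_transpose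

text \<open>\<open>scalar_product\<close> is bilinear, without conjugation, as the transposes in the
  formula require. The Hermitian form, needed only for stability, is therefore written
  \<open>scalar_product (vcnj x) y\<close>.\<close>

definition vcnj :: "complex^'n \<Rightarrow> complex^'n" where
  "vcnj x = (\<chi> i. cnj (x $ i))"

lemma vcnj_nth [simp]: "vcnj x $ i = cnj (x $ i)"
  by (simp add: vcnj_def)

lemma vcnj_mult_cmat: "vcnj (x v* cmat A) = vcnj x v* cmat A"
  by (simp add: vec_eq_iff vector_matrix_mult_def)

lemma vcnj_scale: "vcnj (c *s x) = cnj c *s vcnj x"
  by (simp add: vec_eq_iff)

lemma scalar_product_add_right:
  "scalar_product x (y + z) = scalar_product x y + scalar_product x z"
  by (simp add: scalar_product_def distrib_left sum.distrib)

lemma scalar_product_scale_right: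
  "scalar_product x (c *s y) = (c :: 'a::comm_semiring_1) * scalar_product x y"
  by (simp add: scalar_product_def sum_distrib_left mult_ac)

lemma scalar_product_scale_left:
  "scalar_product (c *s x) y = (c :: 'a::comm_semiring_1) * scalar_product x y"
  by (simp add: scalar_product_def sum_distrib_left mult_ac)

lemma scalar_product_matrix:
  fixes A :: "'a::comm_semiring_1^'n^'m"
  shows "scalar_product x (A *v y) = scalar_product (x v* A) y"
proof -
  have "scalar_product x (A *v y) = (\<Sum>i\<in>UNIV. \<Sum>j\<in>UNIV. x $ i * A $ i $ j * y $ j)"
    by (simp add: scalar_product_def matrix_vector_mult_def sum_distrib_left mult.assoc)
  also have "\<dots> = (\<Sum>j\<in>UNIV. \<Sum>i\<in>UNIV. x $ i * A $ i $ j * y $ j)"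
    by (rule sum.swap)
  finally show ?thesis
    by (simp add: scalar_product_def vector_matrix_mult_def sum_distrib_left mult_ac)
qed

lemma scalar_product_vcnj: "scalar_product (vcnj x) x = of_real ((norm x)\<^sup>2)"
proof -
  have "scalar_product (vcnj x) x = (\<Sum>i\<in>UNIV. complex_of_real ((cmod (x $ i))\<^sup>2))"
    by (simp add: scalar_product_def complex_norm_square mult.commute del: of_real_power)
  then show ?thesis
    by (simp add: norm_vec_def L2_set_def sum_nonneg)
qed

text \<open>With w = x + iy, the cross terms of (x - iy)^T P (x + iy) are purely imaginary, so the
  real part is the sum of two real quadratic forms.\<close>

lemma pos_semidef_complex:
  assumes "pos_semidef P"
  shows "0 \<le> Re (scalar_product (vcnj w) (cmat P *v w))"
proof -
  define x y where "x = (\<chi> i. Re (w $ i))" and "y = (\<chi> i. Im (w $ i))"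
  have "Re (scalar_product (vcnj w) (cmat P *v w)) = x \<bullet> (P *v x) + y \<bullet> (P *v y)"
    by (simp add: scalar_product_def matrix_vector_mult_def inner_vec_def x_def y_def
        sum.distrib)
  then show ?thesis
    using assms by (simp add: pos_semidef_def)
qed

section \<open>Eigenvalues, resolvents and left eigenbases\<close>

lemma mat_mult_vector: "mat s *v x = s *s (x :: 'a::comm_semiring_1^'n)"
  by (simp add: vec_eq_iff matrix_vector_mult_def mat_def if_distrib if_distribR cong: if_cong)

lemma vector_mult_mat: "x v* mat s = s *s (x :: 'a::comm_semiring_1^'n)"
  by (metis transpose_mat transpose_matrix_vector mat_mult_vector)

lemma not_eigenvalue_inv:
  assumes "\<not> is_eigenvalue A s"
  shows "(mat s - cmat A) ** matrix_inv (mat s - cmat A) = mat 1"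
    and "matrix_inv (mat s - cmat A) ** (mat s - cmat A) = mat 1"
proof -
  have "x = 0" if "(mat s - cmat A) *v x = 0" for x
    using assms that by (auto simp: is_eigenvalue_def matrix_vector_mult_diff_rdistrib mat_mult_vector)
  then obtain Z where Z: "Z ** (mat s - cmat A) = mat 1"
    using matrix_left_invertible_ker[of "mat s - cmat A"] by blast
  then have Z': "(mat s - cmat A) ** Z = mat 1"
    by (simp add: matrix_left_right_inverse)
  show "(mat s - cmat A) ** matrix_inv (mat s - cmat A) = mat 1"
       "matrix_inv (mat s - cmat A) ** (mat s - cmat A) = mat 1"
    using Z Z' by (simp_all add: matrix_inv_unique[OF Z'])
qed

text \<open>\<open>is_eigenvalue\<close> speaks of right eigenvectors. If z were none, multiplying
  w^T (zI - A) = 0 by the resolvent would give w = 0.\<close>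

lemma left_eigenvector_eigenvalue:
  assumes "w \<noteq> 0" and "w v* cmat A = z *s w"
  shows "is_eigenvalue A z"
proof (rule ccontr)
  assume "\<not> is_eigenvalue A z"
  from not_eigenvalue_inv(1)[OF this]
  have "w = w v* ((mat z - cmat A) ** matrix_inv (mat z - cmat A))"
    by simp
  also have "\<dots> = (w v* (mat z - cmat A)) v* matrix_inv (mat z - cmat A)"
    by (simp add: vector_matrix_mul_assoc)
  also have "\<dots> = 0"
    using assms(2) by (simp add: vector_matrix_mult_diff_rdistrib vector_mult_mat)
  finally show False using assms(1) by simp
qed

text \<open>Pairing a right eigenvector x for s with each basis vector gives (s - \<mu>_i) w_i^T x =
  0. If s were none of the \<mu>_i, x would be annihilated by a whole basis.\<close>

lemma left_eigenbasis_eigenvalue: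
  assumes E: "left_eigenbasis A \<mu> W" and "is_eigenvalue A s"
  shows "\<exists>i. s = \<mu> i"
proof (rule ccontr)
  assume neq: "\<nexists>i. s = \<mu> i"
  obtain x where x: "x \<noteq> 0" "cmat A *v x = s *s x"
    using assms(2) by (auto simp: is_eigenvalue_def)
  have "scalar_product (column i W) x = 0" for i
  proof -
    have "s * scalar_product (column i W) x = scalar_product (column i W) (cmat A *v x)"
      by (simp add: x(2) scalar_product_scale_right)
    also have "\<dots> = \<mu> i * scalar_product (column i W) x"
      using E by (simp add: left_eigenbasis_def scalar_product_matrix scalar_product_scale_left)
    finally show ?thesis using neq by auto
  qed
  then have "transpose W *v x = 0"
    by (simp add: vec_eq_iff scalar_product_def column_def vector_matrix_mult_def mult.commute)
  moreover obtain Y where "W ** Y = mat 1"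
    using E by (auto simp: left_eigenbasis_def invertible_def)
  then have "transpose Y ** transpose W = mat 1"
    by (metis matrix_transpose_mul transpose_mat)
  ultimately have "x = 0"
    by (metis matrix_vector_mul_assoc matrix_vector_mul_lid matrix_vector_mult_0_right)
  with x(1) show False ..
qed

lemma left_eigenbasis_column_nonzero:
  assumes "left_eigenbasis A \<mu> W"
  shows "column i W \<noteq> 0"
proof
  assume z: "column i W = 0"
  obtain Y where "Y ** W = mat 1"
    using assms by (auto simp: left_eigenbasis_def invertible_def)
  then have "(Y ** W) $ i $ i = 1" by (simp add: mat_def)
  moreover have "(Y ** W) $ i $ i = (\<Sum>k\<in>UNIV. Y $ i $ k * column i W $ k)"
    by (simp add: matrix_matrix_mult_def column_def)
  ultimately show False by (simp add: z)
qed

section \<open>The Riccati equation along left eigenvectors of the closed loop\<close>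

lemma gain_left_mult:
  assumes "transpose P = P"
  shows "w v* cmat (gain C P) = cmat C *v (cmat P *v w)"
proof -
  have "transpose (gain C P) = C ** P"
    using assms by (simp add: gain_def matrix_transpose_mul)
  then have "transpose (cmat (gain C P)) = cmat C ** cmat P"
    by (metis cmat_mult cmat_transpose)
  then show ?thesis
    by (metis matrix_vector_mul_assoc transpose_matrix_vector)
qed

lemma transpose_diff: "transpose (A - B) = transpose A - transpose B"
  by (simp add: vec_eq_iff transpose_def)

lemma matrix_diff_ldistrib:
  fixes A :: "'a::ring_1^'n^'m"
  shows "A ** (B - C) = A ** B - A ** C"
  by (simp add: vec_eq_iff matrix_matrix_mult_def right_diff_distrib sum_subtractf)

text \<open>Writing A_F for the closed loop, symmetry of P gives P A_F^T = P A^T - P C^T C P. The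
  quadratic term is thus absorbed, leaving A P + P A_F^T + B B^T = 0, and A_F^T w =
  \<open>\<mu> *s w\<close> evaluates the middle term at w.\<close>

lemma riccati_left_eigenvector:
  assumes R: "riccati_solution A B C P"
    and w: "w v* cmat (closed_loop A C P) = \<mu> *s w"
  shows "cmat A *v (cmat P *v w) + \<mu> *s (cmat P *v w) + cmat B *v (w v* cmat B) = 0"
proof -
  have sym: "transpose P = P"
    using R by (simp add: riccati_solution_def pos_semidef_def)
  have eq: "P ** transpose (closed_loop A C P) = P ** transpose A - P ** transpose C ** C ** P"
    using sym by (simp add: closed_loop_def gain_def transpose_diff matrix_transpose_mul
        matrix_diff_ldistrib matrix_mul_assoc)
  have "A ** P + P ** transpose (closed_loop A C P) + B ** transpose B = 0"
    using R unfolding eq riccati_solution_def by (metis add_diff_eq)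
  then have "cmat (A ** P + P ** transpose (closed_loop A C P) + B ** transpose B) *v w = 0"
    by (simp add: cmat_zero)
  then have "cmat A *v (cmat P *v w) + cmat P *v (transpose (cmat (closed_loop A C P)) *v w)
      + cmat B *v (transpose (cmat B) *v w) = 0"
    by (simp only: cmat_simps matrix_vector_mult_add_rdistrib matrix_vector_mul_assoc)
  then show ?thesis
    by (simp add: w vector_scalar_commute)
qed

lemma riccati_left_eigenvector_solve:
  assumes R: "riccati_solution A B C P"
    and w: "w v* cmat (closed_loop A C P) = \<mu> *s w"
  shows "(- \<mu>) *s (cmat P *v w) - cmat A *v (cmat P *v w) = cmat B *v (w v* cmat B)"
proof -
  have "cmat B *v (w v* cmat B) = - (cmat A *v (cmat P *v w) + \<mu> *s (cmat P *v w))"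
    using minus_unique[OF riccati_left_eigenvector[OF R w]] by (rule sym)
  then show ?thesis by (simp add: vec_eq_iff)
qed

lemma closed_loop_mult:
  "cmat (closed_loop A C P) *v x = cmat A *v x - cmat (gain C P) *v (cmat C *v x)"
  by (simp add: closed_loop_def cmat_simps matrix_vector_mult_diff_rdistrib matrix_vector_mul_assoc)

text \<open>If \<open>Re \<mu> \<ge> 0\<close>, the Lyapunov form of the Riccati equation at \<open>w\<close> forces \<open>w\<^sup>T F = 0\<close> and
  \<open>w\<^sup>T B = 0\<close>, so \<open>\<mu>\<close> is an eigenvalue of \<open>A - B K\<close> for every \<open>K\<close>.\<close>

lemma closed_loop_stable:
  assumes st: "stabilizable A B" and R: "riccati_solution A B C P"
    and w: "w v* cmat (closed_loop A C P) = \<mu> *s w" and nz: "w \<noteq> 0"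
  shows "Re \<mu> < 0"
proof (rule ccontr)
  assume "\<not> Re \<mu> < 0"
  then have pos: "Re \<mu> \<ge> 0" by simp
  have P: "pos_semidef P" and sym: "transpose P = P"
    using R by (simp_all add: riccati_solution_def pos_semidef_def)
  note gl = gain_left_mult[OF sym]
  define v where "v = cmat P *v w"
  define q where "q = scalar_product (vcnj w) v"
  \<comment> \<open>Splitting A into closed loop plus F C prepares the pairing with
    \<open>vcnj w\<close>: the closed loop is real, so \<open>vcnj w\<close> is a left eigenvector
    for \<open>cnj \<mu>\<close>, and C v = F^T w turns the F C term into a squared norm.\<close>
  have "cmat (closed_loop A C P) *v v + cmat (gain C P) *v (cmat C *v v) + \<mu> *s v
      + cmat B *v (w v* cmat B) = 0"
    using riccati_left_eigenvector[OF R w] by (simp add: closed_loop_mult v_def)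
  then have "scalar_product (vcnj w) (cmat (closed_loop A C P) *v v
      + cmat (gain C P) *v (cmat C *v v) + \<mu> *s v + cmat B *v (w v* cmat B)) = 0"
    by (simp add: scalar_product_def)
  moreover have "scalar_product (vcnj w) (cmat (closed_loop A C P) *v v) = cnj \<mu> * q"
    by (simp add: scalar_product_matrix q_def w vcnj_scale scalar_product_scale_left
        flip: vcnj_mult_cmat)
  moreover have "scalar_product (vcnj w) (cmat (gain C P) *v (cmat C *v v))
      = of_real ((norm (w v* cmat (gain C P)))\<^sup>2)"
    by (simp only: scalar_product_matrix[of "vcnj w"] v_def gl[symmetric] vcnj_mult_cmat[symmetric]
        scalar_product_vcnj)
  moreover have "scalar_product (vcnj w) (cmat B *v (w v* cmat B))
      = of_real ((norm (w v* cmat B))\<^sup>2)"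
    by (simp only: scalar_product_matrix[of "vcnj w"] scalar_product_vcnj vcnj_mult_cmat[symmetric])
  ultimately have "cnj \<mu> * q + of_real ((norm (w v* cmat (gain C P)))\<^sup>2) + \<mu> * q
      + of_real ((norm (w v* cmat B))\<^sup>2) = 0"
    by (simp add: scalar_product_add_right scalar_product_scale_right q_def)
  from arg_cong[OF this, of Re]
  have "2 * Re \<mu> * Re q + (norm (w v* cmat (gain C P)))\<^sup>2 + (norm (w v* cmat B))\<^sup>2 = 0"
    by (simp add: algebra_simps)
  moreover have "Re \<mu> * Re q \<ge> 0"
    using pos pos_semidef_complex[OF P, of w] by (simp add: q_def v_def)
  ultimately have "(norm (w v* cmat (gain C P)))\<^sup>2 \<le> 0" "(norm (w v* cmat B))\<^sup>2 \<le> 0"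
    using zero_le_power2[of "norm (w v* cmat (gain C P))"] zero_le_power2[of "norm (w v* cmat B)"]
    by linarith+
  then have F0: "w v* cmat (gain C P) = 0" and B0: "w v* cmat B = 0"
    by simp_all
  obtain K where K: "asymptotically_stable (A - B ** K)"
    using st by (auto simp: stabilizable_def)
  have "w v* cmat A = \<mu> *s w"
    using w F0 by (simp add: closed_loop_def cmat_simps vector_matrix_mult_diff_rdistrib
        flip: vector_matrix_mul_assoc)
  then have "w v* cmat (A - B ** K) = \<mu> *s w"
    using B0 by (simp add: cmat_simps vector_matrix_mult_diff_rdistrib
        flip: vector_matrix_mul_assoc)
  then have "Re \<mu> < 0"
    using K left_eigenvector_eigenvalue[OF nz] by (auto simp: asymptotically_stable_def)
  with pos show False by simp
qed

subsection \<open>The energy of a sum of simple poles\<close>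

text \<open>These are the real parts of the two logarithms in the antiderivative of the resolvent
  product: each diverges like ln |w|, so their difference vanishes at both ends. The arctangents of
  the next lemma are the imaginary parts.\<close>

lemma ln_quotient_tendsto:
  fixes u v x y :: real
  shows "((\<lambda>w. ln (sqrt (x\<^sup>2 + (w + y)\<^sup>2)) - ln (sqrt (u\<^sup>2 + (w + v)\<^sup>2))) \<longlongrightarrow> 0) at_top"
    and "((\<lambda>w. ln (sqrt (x\<^sup>2 + (w + y)\<^sup>2)) - ln (sqrt (u\<^sup>2 + (w + v)\<^sup>2))) \<longlongrightarrow> 0) at_bot"
  by real_asymp+

lemma arctan_line_tendsto:
  fixes x y :: real
  assumes "x > 0"
  shows "((\<lambda>w. arctan ((w + y) / x)) \<longlongrightarrow> pi / 2) at_top"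
    and "((\<lambda>w. arctan ((w + y) / x)) \<longlongrightarrow> - pi / 2) at_bot"
  using assms by real_asymp+

lemma Im_Ln_arctan:
  assumes "Re z > 0"
  shows "Im (Ln z) = arctan (Im z / Re z)"
  using assms by (subst Im_Ln_eq) auto

text \<open>The integrand is 1 / ((Re a)^2 + (w + Im a)^2). Its arctangent antiderivative has finite
  limits, which for a nonnegative integrand already yields integrability.\<close>

lemma square_resolvent_integrable:
  assumes "Re a > 0"
  shows "integrable lborel (\<lambda>w. 1 / (cmod (a + \<i> * of_real w))\<^sup>2)"
proof -
  let ?F = "\<lambda>w. arctan ((w + Im a) / Re a) / Re a"
  have cm: "(cmod (a + \<i> * of_real w))\<^sup>2 = (Re a)\<^sup>2 + (w + Im a)\<^sup>2" for w
    by (simp add: cmod_power2 add.commute)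
  have pos: "(Re a)\<^sup>2 + (w + Im a)\<^sup>2 > 0" for w
    using assms by (simp add: add_pos_nonneg)
  have "set_integrable lborel (einterval (-\<infinity>) \<infinity>) (\<lambda>w. 1 / ((Re a)\<^sup>2 + (w + Im a)\<^sup>2))"
  proof (rule interval_integral_FTC_nonneg(1)[where F = ?F])
    show "DERIV ?F w :> 1 / ((Re a)\<^sup>2 + (w + Im a)\<^sup>2)" for w
      using assms pos[of w]
      by (auto intro!: derivative_eq_intros simp: divide_simps power2_eq_square)
    show "isCont (\<lambda>w. 1 / ((Re a)\<^sup>2 + (w + Im a)\<^sup>2)) w" for w
      using pos[of w] by (intro continuous_intros) auto
    show "((?F \<circ> real_of_ereal) \<longlongrightarrow> (- pi / 2) / Re a) (at_right (- \<infinity>))"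
      using assms unfolding ereal_tendsto_simps
      by (intro tendsto_divide arctan_line_tendsto(2) tendsto_const) auto
    show "((?F \<circ> real_of_ereal) \<longlongrightarrow> (pi / 2) / Re a) (at_left \<infinity>)"
      using assms unfolding ereal_tendsto_simps
      by (intro tendsto_divide arctan_line_tendsto(1) tendsto_const) auto
  qed (use pos in \<open>auto intro!: less_imp_le\<close>)
  then show ?thesis
    by (simp add: cm set_integrable_def einterval_def)
qed

text \<open>The L2 inner product of two simple poles on a vertical line. The difference of
  logarithms grows by 2 pi i from one end to the other, and dividing by i (a + \<open>cnj b\<close>)
  gives the value.\<close>

lemma resolvent_product_integral:
  assumes a: "Re a > 0" and b: "Re b > 0"
  shows "has_bochner_integral lborel
    (\<lambda>w. 1 / ((a + \<i> * of_real w) * cnj (b + \<i> * of_real w))) (2 * pi / (a + cnj b))"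
proof -
  let ?f = "\<lambda>w. 1 / ((a + \<i> * of_real w) * (cnj b - \<i> * of_real w))"
  text \<open>The antiderivative comes from partial fractions; both arguments of \<open>Ln\<close> stay in the right
    half-plane, away from the branch cut.\<close>
  let ?F = "\<lambda>w. (Ln (a + \<i> * of_real w) - Ln (cnj b - \<i> * of_real w)) / (\<i> * (a + cnj b))"
  have re: "Re (a + \<i> * of_real w) > 0" "Re (cnj b - \<i> * of_real w) > 0" for w
    using a b by simp_all
  have nz: "a + \<i> * of_real w \<noteq> 0" "cnj b - \<i> * of_real w \<noteq> 0" for w
    using re[of w] a b by (auto simp: complex_eq_iff)
  have ab: "a + cnj b \<noteq> 0"
    using a b by (auto simp: complex_eq_iff)
  have nonpos: "a + \<i> * of_real w \<notin> \<real>\<^sub>\<le>\<^sub>0" "cnj b - \<i> * of_real w \<notin> \<real>\<^sub>\<le>\<^sub>0" for w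
    using re[of w] by (auto simp: complex_nonpos_Reals_iff)
  have cont: "continuous_on UNIV ?f"
    using nz by (intro continuous_intros) auto
  \<comment> \<open>Domination by the squared resolvents, through p q \<le> (p^2 + q^2) / 2.\<close>
  have int: "integrable lborel ?f"
  proof (rule Bochner_Integration.integrable_bound)
    show "integrable lborel (\<lambda>w. (1 / (cmod (a + \<i> * of_real w))\<^sup>2
        + 1 / (cmod (b + \<i> * of_real w))\<^sup>2) / 2)"
      using square_resolvent_integrable[OF a] square_resolvent_integrable[OF b] by simp
    show "?f \<in> borel_measurable lborel"
      using borel_measurable_continuous_onI[OF cont] by simp
    have "norm (?f w) \<le> norm ((1 / (cmod (a + \<i> * of_real w))\<^sup>2
        + 1 / (cmod (b + \<i> * of_real w))\<^sup>2) / 2)" for w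
    proof -
      define p q where "p = 1 / cmod (a + \<i> * of_real w)" and "q = 1 / cmod (b + \<i> * of_real w)"
      have "cmod (cnj b - \<i> * of_real w) = cmod (b + \<i> * of_real w)"
        by (simp add: cmod_def power2_eq_square algebra_simps)
      then have "norm (?f w) = p * q"
        by (simp add: norm_divide norm_mult p_def q_def)
      also have "\<dots> \<le> (p\<^sup>2 + q\<^sup>2) / 2"
        using sum_squares_bound[of p q] by simp
      finally show ?thesis by (simp add: p_def q_def power_one_over)
    qed
    then show "AE w in lborel. norm (?f w) \<le> norm ((1 / (cmod (a + \<i> * of_real w))\<^sup>2
        + 1 / (cmod (b + \<i> * of_real w))\<^sup>2) / 2)" by simp
  qed
  \<comment> \<open>Here \<open>c\<close> will be pi at the upper end and - pi at the lower one. The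
    conjugation in the second factor flips the sign of its argument, so the two limits
    \<open>c / 2\<close> add up.\<close>
  have lim: "((\<lambda>w. Ln (a + \<i> * of_real w) - Ln (cnj b - \<i> * of_real w)) \<longlongrightarrow> \<i> * of_real c) F"
    if F: "((\<lambda>w. ln (sqrt ((Re a)\<^sup>2 + (w + Im a)\<^sup>2)) - ln (sqrt ((Re b)\<^sup>2 + (w + Im b)\<^sup>2)))
         \<longlongrightarrow> 0) F"
      "((\<lambda>w. arctan ((w + Im a) / Re a)) \<longlongrightarrow> c / 2) F"
      "((\<lambda>w. arctan ((w + Im b) / Re b)) \<longlongrightarrow> c / 2) F" for c F
  proof -
    have "((\<lambda>w. arctan ((w + Im a) / Re a) + arctan ((w + Im b) / Re b)) \<longlongrightarrow> c / 2 + c / 2) F"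
      by (intro tendsto_add F)
    moreover have "Im (Ln (cnj b - \<i> * of_real w)) = - arctan ((w + Im b) / Re b)" for w
    proof -
      have "Im (cnj b - \<i> * of_real w) / Re (cnj b - \<i> * of_real w) = - ((w + Im b) / Re b)"
        by (simp add: minus_divide_left)
      then show ?thesis
        using re(2)[of w] by (simp add: Im_Ln_arctan arctan_minus)
    qed
    moreover have "Im (Ln (a + \<i> * of_real w)) = arctan ((w + Im a) / Re a)" for w
      using a by (simp add: Im_Ln_arctan add.commute)
    ultimately have "((\<lambda>w. Im (Ln (a + \<i> * of_real w) - Ln (cnj b - \<i> * of_real w))) \<longlongrightarrow> c) F"
      by simp
    moreover have "Re (Ln (a + \<i> * of_real w)) = ln (sqrt ((Re a)\<^sup>2 + (w + Im a)\<^sup>2))" for w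
      using nz by (simp add: cmod_def add.commute)
    moreover have "Re (Ln (cnj b - \<i> * of_real w)) = ln (sqrt ((Re b)\<^sup>2 + (w + Im b)\<^sup>2))" for w
      using nz by (simp add: cmod_def power2_eq_square algebra_simps)
    ultimately show ?thesis
      using F(1) by (simp add: tendsto_complex_iff)
  qed
  have "(LBINT w=-\<infinity>..\<infinity>. ?f w) = \<i> * of_real pi / (\<i> * (a + cnj b))
      - \<i> * of_real (- pi) / (\<i> * (a + cnj b))"
  proof (rule interval_integral_FTC_integrable[where F = ?F])
    show "(?F has_vector_derivative ?f w) (at w)" for w
    proof -
      let ?p = "a + \<i> * of_real w" and ?q = "cnj b - \<i> * of_real w"
      \<comment> \<open>The derivative is taken in a complex variable and then restricted to the
        real line.\<close>
      have "((\<lambda>z. (Ln (a + \<i> * z) - Ln (cnj b - \<i> * z)) / (\<i> * (a + cnj b)))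
          has_field_derivative (inverse ?p * \<i> - inverse ?q * (- \<i>)) / (\<i> * (a + cnj b)))
          (at (of_real w))"
        using nonpos[of w] ab by (auto intro!: derivative_eq_intros)
      also have "(inverse ?p * \<i> - inverse ?q * (- \<i>)) / (\<i> * (a + cnj b)) = ?f w"
      proof -
        have "inverse ?p * \<i> - inverse ?q * (- \<i>) = \<i> * (?p + ?q) / (?p * ?q)"
          using nz[of w] by (simp add: field_simps)
        also have "?p + ?q = a + cnj b" by simp
        finally show ?thesis using ab by simp
      qed
      finally have "((\<lambda>z. (Ln (a + \<i> * z) - Ln (cnj b - \<i> * z)) / (\<i> * (a + cnj b)))
          has_field_derivative ?f w) (at (of_real w))" .
      from has_vector_derivative_real_field[OF this] show ?thesis by (simp add: o_def)
    qed
    show "isCont ?f w" for w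
      using cont by (simp add: continuous_on_eq_continuous_at)
    show "set_integrable lborel (einterval (-\<infinity>) \<infinity>) ?f"
      using int by (simp add: set_integrable_def einterval_def)
    show "((?F \<circ> real_of_ereal) \<longlongrightarrow> \<i> * of_real (- pi) / (\<i> * (a + cnj b))) (at_right (- \<infinity>))"
      unfolding ereal_tendsto_simps using ab
      by (intro tendsto_divide lim ln_quotient_tendsto arctan_line_tendsto a b tendsto_const) auto
    show "((?F \<circ> real_of_ereal) \<longlongrightarrow> \<i> * of_real pi / (\<i> * (a + cnj b))) (at_left \<infinity>)"
      unfolding ereal_tendsto_simps using ab
      by (intro tendsto_divide lim ln_quotient_tendsto arctan_line_tendsto a b tendsto_const) auto
  qed simp
  then have "integral\<^sup>L lborel ?f = 2 * pi / (a + cnj b)"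
    using ab by (simp add: interval_lebesgue_integral_def set_lebesgue_integral_def
        einterval_def add_divide_distrib)
  with int show ?thesis
    by (simp add: has_bochner_integral_iff)
qed

text \<open>Parseval's value, up to the factor \<open>2 \<pi>\<close>, of the energy of \<open>s \<mapsto> \<Sum>\<^sub>k r\<^sub>k / (s - \<nu>\<^sub>k)\<close> on the
  line \<open>Re s = \<sigma>\<close>.\<close>

definition pole_gram :: "('k::finite \<Rightarrow> complex) \<Rightarrow> ('k \<Rightarrow> complex) \<Rightarrow> real \<Rightarrow> complex" where
  "pole_gram r \<nu> \<sigma> =
     (\<Sum>k\<in>UNIV. \<Sum>l\<in>UNIV. r k * cnj (r l) / (2 * of_real \<sigma> - \<nu> k - cnj (\<nu> l)))"

lemma pole_gram_denominator:
  assumes "Re a < 0" and "Re b < 0" and "\<sigma> \<ge> 0"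
  shows "2 * of_real \<sigma> - a - cnj b \<noteq> 0"
  using assms by (auto simp: complex_eq_iff)

lemma pole_sum_integral:
  fixes r \<nu> :: "'k::finite \<Rightarrow> complex"
  assumes stable: "\<And>k. Re (\<nu> k) < 0" and \<sigma>: "\<sigma> \<ge> 0"
  shows "has_bochner_integral lborel
      (\<lambda>w. complex_of_real ((cmod (\<Sum>k\<in>UNIV. r k / (Complex \<sigma> w - \<nu> k)))\<^sup>2))
      (2 * pi * pole_gram r \<nu> \<sigma>)"
proof -
  \<comment> \<open>Shifting by \<sigma> makes the denominators on the line Re s = \<sigma> equal to
    \<open>a k + \<i> * of_real w\<close> with Re (a k) > 0.\<close>
  define a where "a k = of_real \<sigma> - \<nu> k" for k
  have a: "Re (a k) > 0" for k
    using stable[of k] \<sigma> by (simp add: a_def)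
  have "has_bochner_integral lborel
      (\<lambda>w. \<Sum>k\<in>UNIV. \<Sum>l\<in>UNIV. r k * cnj (r l) *
        (1 / ((a k + \<i> * of_real w) * cnj (a l + \<i> * of_real w))))
      (\<Sum>k\<in>UNIV. \<Sum>l\<in>UNIV. r k * cnj (r l) * (2 * pi / (a k + cnj (a l))))"
    by (intro has_bochner_integral_sum has_bochner_integral_mult_right resolvent_product_integral a)
  also have "(\<Sum>k\<in>UNIV. \<Sum>l\<in>UNIV. r k * cnj (r l) * (2 * pi / (a k + cnj (a l))))
      = 2 * pi * pole_gram r \<nu> \<sigma>"
    by (simp add: pole_gram_def sum_distrib_left a_def algebra_simps)
  also have "(\<lambda>w. \<Sum>k\<in>UNIV. \<Sum>l\<in>UNIV. r k * cnj (r l) *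
        (1 / ((a k + \<i> * of_real w) * cnj (a l + \<i> * of_real w))))
      = (\<lambda>w. complex_of_real ((cmod (\<Sum>k\<in>UNIV. r k / (Complex \<sigma> w - \<nu> k)))\<^sup>2))"
  proof
    fix w
    have s: "Complex \<sigma> w - \<nu> k = a k + \<i> * of_real w" for k
      by (simp add: a_def complex_eq_iff)
    show "(\<Sum>k\<in>UNIV. \<Sum>l\<in>UNIV. r k * cnj (r l) *
        (1 / ((a k + \<i> * of_real w) * cnj (a l + \<i> * of_real w))))
      = complex_of_real ((cmod (\<Sum>k\<in>UNIV. r k / (Complex \<sigma> w - \<nu> k)))\<^sup>2)"
      unfolding complex_norm_square s cnj_sum sum_product by simp
  qed
  finally show ?thesis .
qed

text \<open>Being the integral of a real function up to 2 pi, the complex double sum is real. This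
  later allows \<open>Re\<close> to be dropped from the formula for the norm.\<close>

lemma pole_gram_eq_integral:
  fixes r \<nu> :: "'k::finite \<Rightarrow> complex"
  assumes stable: "\<And>k. Re (\<nu> k) < 0" and \<sigma>: "\<sigma> \<ge> 0"
  defines "f \<equiv> \<lambda>w. (cmod (\<Sum>k\<in>UNIV. r k / (Complex \<sigma> w - \<nu> k)))\<^sup>2"
  shows "integrable lborel f" and "integral\<^sup>L lborel f = 2 * pi * Re (pole_gram r \<nu> \<sigma>)"
    and "of_real (Re (pole_gram r \<nu> \<sigma>)) = pole_gram r \<nu> \<sigma>"
proof -
  have *: "has_bochner_integral lborel (\<lambda>w. complex_of_real (f w)) (2 * pi * pole_gram r \<nu> \<sigma>)"
    using pole_sum_integral[OF stable \<sigma>, of r] by (simp add: f_def)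
  then show "integrable lborel f"
    by (simp add: has_bochner_integral_iff complex_of_real_integrable_eq)
  have "of_real (integral\<^sup>L lborel f) = 2 * pi * pole_gram r \<nu> \<sigma>"
    using * by (simp add: has_bochner_integral_iff)
  then have **: "of_real (integral\<^sup>L lborel f / (2 * pi)) = pole_gram r \<nu> \<sigma>"
    by simp
  then have "integral\<^sup>L lborel f / (2 * pi) = Re (pole_gram r \<nu> \<sigma>)"
    by (metis Re_complex_of_real)
  with ** show "of_real (Re (pole_gram r \<nu> \<sigma>)) = pole_gram r \<nu> \<sigma>"
    and "integral\<^sup>L lborel f = 2 * pi * Re (pole_gram r \<nu> \<sigma>)"
    by (simp_all add: field_simps)
qed

lemma pole_gram_nonneg:
  assumes "\<And>k. Re (\<nu> k) < 0" and "\<sigma> \<ge> 0"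
  shows "Re (pole_gram r \<nu> \<sigma>) \<ge> 0"
proof -
  have "0 \<le> 2 * pi * Re (pole_gram r \<nu> \<sigma>)"
    unfolding pole_gram_eq_integral(2)[OF assms, symmetric] by (rule Bochner_Integration.integral_nonneg) simp
  then show ?thesis using pi_gt_zero by (simp add: zero_le_mult_iff)
qed

text \<open>At a fixed height the integrand on the line need not decrease in \<sigma>, since the
  pole sum may vanish on the axis. Only the integral does, hence the detour through the impulse
  response.\<close>

lemma pole_gram_antimono:
  fixes r \<nu> :: "'k::finite \<Rightarrow> complex"
  assumes stable: "\<And>k. Re (\<nu> k) < 0" and \<sigma>: "0 \<le> \<sigma>" "\<sigma> \<le> \<tau>"
  shows "Re (pole_gram r \<nu> \<tau>) \<le> Re (pole_gram r \<nu> \<sigma>)"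
proof -
  define d where "d k l u = 2 * of_real u - \<nu> k - cnj (\<nu> l)" for k l u
  text \<open>\<open>E u t\<close> is the integral over \<open>x \<ge> t\<close> of \<open>exp (- 2 u x) \<bar>h x\<bar>\<^sup>2\<close>, where
    \<open>h x = \<Sum>\<^sub>k r\<^sub>k exp (\<nu>\<^sub>k x)\<close> is the impulse response; its value at \<open>t = 0\<close> is the Gram sum, so
    monotonicity in \<open>u\<close> can be read off in the time domain.\<close>
  define E where "E u t = Re (\<Sum>k\<in>UNIV. \<Sum>l\<in>UNIV.
      r k * cnj (r l) * exp (- (d k l u * of_real t)) / d k l u)" for u t
  have d: "Re (d k l u) > 0" "d k l u \<noteq> 0" if "u \<ge> 0" for k l u
    using pole_gram_denominator[OF stable stable that] stable[of k] stable[of l] that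
    by (auto simp: d_def)
  have deriv: "(E u has_real_derivative
      - (exp (- (2 * u * t)) * (cmod (\<Sum>k\<in>UNIV. r k * exp (\<nu> k * of_real t)))\<^sup>2)) (at t)"
    if u: "u \<ge> 0" for u t
  proof -
    have "((\<lambda>z. \<Sum>k\<in>UNIV. \<Sum>l\<in>UNIV. r k * cnj (r l) * exp (- (d k l u * z)) / d k l u)
        has_field_derivative (\<Sum>k\<in>UNIV. \<Sum>l\<in>UNIV. - (r k * cnj (r l) * exp (- (d k l u * of_real t)))))
        (at (of_real t))"
    proof (intro DERIV_sum)
      fix k l
      show "((\<lambda>z. r k * cnj (r l) * exp (- (d k l u * z)) / d k l u)
        has_field_derivative - (r k * cnj (r l) * exp (- (d k l u * of_real t)))) (at (of_real t))"
        using d(2)[OF u, of k l] by (auto intro!: derivative_eq_intros)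
    qed
    from has_field_derivative_Re[OF has_vector_derivative_real_field[OF this]]
    have "(E u has_real_derivative Re (\<Sum>k\<in>UNIV. \<Sum>l\<in>UNIV.
        - (r k * cnj (r l) * exp (- (d k l u * of_real t))))) (at t)"
      by (simp add: o_def E_def[abs_def])
    also have "(\<Sum>k\<in>UNIV. \<Sum>l\<in>UNIV. - (r k * cnj (r l) * exp (- (d k l u * of_real t)))) =
        - of_real (exp (- (2 * u * t)) * (cmod (\<Sum>k\<in>UNIV. r k * exp (\<nu> k * of_real t)))\<^sup>2)"
    proof -
      have "exp (- (d k l u * of_real t)) =
          of_real (exp (- (2 * u * t))) * (exp (\<nu> k * of_real t) * cnj (exp (\<nu> l * of_real t)))" for k l
        by (simp add: d_def exp_of_real[symmetric] exp_cnj algebra_simps flip: exp_add)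
      then show ?thesis
        unfolding of_real_mult complex_norm_square cnj_sum sum_product
        by (simp add: sum_negf sum_distrib_left mult_ac)
    qed
    finally show ?thesis by simp
  qed
  have lim: "(E u \<longlongrightarrow> 0) at_top" if u: "u \<ge> 0" for u
  proof -
    have "((\<lambda>t. exp (- (d k l u * of_real t))) \<longlongrightarrow> 0) at_top" for k l
    proof (rule tendsto_norm_zero_cancel)
      show "((\<lambda>t. norm (exp (- (d k l u * of_real t)))) \<longlongrightarrow> 0) at_top"
        using d(1)[OF u, of k l] unfolding norm_exp_eq_Re by simp real_asymp
    qed
    then have "((\<lambda>t. \<Sum>k\<in>UNIV. \<Sum>l\<in>UNIV.
      r k * cnj (r l) * exp (- (d k l u * of_real t)) / d k l u) \<longlongrightarrow>
      (\<Sum>k\<in>UNIV. \<Sum>l\<in>UNIV. r k * cnj (r l) * 0 / d k l u)) at_top"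
      using d(2)[OF u] by (intro tendsto_intros) auto
    from tendsto_Re[OF this] show ?thesis by (simp add: E_def[abs_def])
  qed
  have \<tau>: "0 \<le> \<tau>" using \<sigma> by simp
  \<comment> \<open>The slope of \<open>?D\<close> at t \<ge> 0 is the squared impulse response
    times exp (-2 \<tau> t) - exp (-2 \<sigma> t), which is at most 0. A nonincreasing function with
    limit 0 at infinity is nonnegative at 0.\<close>
  let ?D = "\<lambda>t. E \<sigma> t - E \<tau> t"
  have mono: "?D t \<le> ?D 0" if "t \<ge> 0" for t
  proof (rule DERIV_nonpos_imp_nonincreasing[OF that])
    fix x :: real assume x: "0 \<le> x"
    define h where "h = (cmod (\<Sum>k\<in>UNIV. r k * exp (\<nu> k * of_real x)))\<^sup>2"
    have "(?D has_real_derivative - (exp (- (2 * \<sigma> * x)) * h) - - (exp (- (2 * \<tau> * x)) * h)) (at x)"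
      unfolding h_def by (intro DERIV_diff deriv \<sigma> \<tau>)
    moreover have "exp (- (2 * \<tau> * x)) * h \<le> exp (- (2 * \<sigma> * x)) * h"
      using \<sigma> x by (intro mult_right_mono) (auto simp: h_def intro: mult_right_mono)
    ultimately show "\<exists>y. (?D has_real_derivative y) (at x) \<and> y \<le> 0"
      by (intro exI conjI) auto
  qed
  have "(?D \<longlongrightarrow> 0 - 0) at_top"
    by (intro tendsto_diff lim \<sigma> \<tau>)
  moreover have "\<forall>\<^sub>F t in at_top. ?D t \<le> ?D 0"
    using eventually_ge_at_top[of 0] by eventually_elim (rule mono)
  ultimately have "0 \<le> ?D 0"
    using tendsto_upperbound[of ?D "0 - 0" at_top "?D 0"] by simp
  then show ?thesis
    by (simp add: E_def pole_gram_def d_def)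
qed

lemma pole_gram_tendsto:
  fixes r \<nu> :: "'k::finite \<Rightarrow> complex"
  assumes "\<And>k. Re (\<nu> k) < 0"
  shows "((\<lambda>\<sigma>. pole_gram r \<nu> \<sigma>) \<longlongrightarrow> pole_gram r \<nu> 0) (at_right 0)"
  unfolding pole_gram_def
  using pole_gram_denominator[OF assms assms, of 0]
  by (intro tendsto_intros) auto

section \<open>Energy and H2 norm of matrix-valued pole sums\<close>

lemma norm_matrix_square: "(norm X)\<^sup>2 = (\<Sum>i\<in>UNIV. \<Sum>j\<in>UNIV. (norm (X $ i $ j))\<^sup>2)"
  by (simp add: norm_vec_def L2_set_def sum_nonneg)

lemma h2_energy_pole_residue:
  fixes \<nu> :: "'k::finite \<Rightarrow> complex" and R :: "'k \<Rightarrow> complex^'m^'p"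
  assumes stable: "\<And>k. Re (\<nu> k) < 0"
    and H: "\<And>s i j. Re s > 0 \<Longrightarrow> H s $ i $ j = (\<Sum>k\<in>UNIV. R k $ i $ j / (s - \<nu> k))"
  shows "h2_energy H =
    ennreal (2 * pi * (\<Sum>i\<in>UNIV. \<Sum>j\<in>UNIV. Re (pole_gram (\<lambda>k. R k $ i $ j) \<nu> 0)))"
proof -
  define q where "q \<sigma> = (\<Sum>i\<in>UNIV. \<Sum>j\<in>UNIV. Re (pole_gram (\<lambda>k. R k $ i $ j) \<nu> \<sigma>))" for \<sigma>
  have int: "(\<integral>\<^sup>+ w. ennreal ((norm (H (Complex \<sigma> w)))\<^sup>2) \<partial>lborel) = ennreal (2 * pi * q \<sigma>)"
    if \<sigma>: "\<sigma> > 0" for \<sigma>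
  proof -
    define f where "f i j w = (cmod (\<Sum>k\<in>UNIV. R k $ i $ j / (Complex \<sigma> w - \<nu> k)))\<^sup>2" for i j w
    have f: "integrable lborel (f i j)"
      "integral\<^sup>L lborel (f i j) = 2 * pi * Re (pole_gram (\<lambda>k. R k $ i $ j) \<nu> \<sigma>)" for i j
      unfolding f_def[abs_def] using pole_gram_eq_integral[OF stable, of \<sigma> "\<lambda>k. R k $ i $ j"] \<sigma>
      by simp_all
    have Hf: "(norm (H (Complex \<sigma> w)))\<^sup>2 = (\<Sum>i\<in>UNIV. \<Sum>j\<in>UNIV. f i j w)" for w
      using \<sigma> by (simp add: norm_matrix_square f_def H)
    have "(\<integral>\<^sup>+ w. ennreal ((norm (H (Complex \<sigma> w)))\<^sup>2) \<partial>lborel)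
        = ennreal (\<integral>w. (\<Sum>i\<in>UNIV. \<Sum>j\<in>UNIV. f i j w) \<partial>lborel)"
      unfolding Hf
      by (intro nn_integral_eq_integral Bochner_Integration.integrable_sum f(1) AE_I2 sum_nonneg)
         (simp add: f_def)
    also have "(\<integral>w. (\<Sum>i\<in>UNIV. \<Sum>j\<in>UNIV. f i j w) \<partial>lborel) = 2 * pi * q \<sigma>"
      using f by (simp add: Bochner_Integration.integral_sum q_def sum_distrib_left)
    finally show ?thesis .
  qed
  have "h2_energy H = (SUP \<sigma>\<in>{0<..}. ennreal (2 * pi * q \<sigma>))"
    unfolding h2_energy_def by (intro SUP_cong refl int) simp
  \<comment> \<open>Monotonicity bounds the supremum by the value at 0. Since 0 lies outside the
    index set, the reverse inequality comes from the limit from the right.\<close>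
  also have "\<dots> = ennreal (2 * pi * q 0)"
  proof (rule antisym)
    show "(SUP \<sigma>\<in>{0<..}. ennreal (2 * pi * q \<sigma>)) \<le> ennreal (2 * pi * q 0)"
      unfolding q_def
      by (intro SUP_least ennreal_leI mult_left_mono sum_mono pole_gram_antimono stable) auto
    have "((\<lambda>\<sigma>. ennreal (2 * pi * q \<sigma>)) \<longlongrightarrow> ennreal (2 * pi * q 0)) (at_right 0)"
      unfolding q_def by (intro tendsto_intros tendsto_ennrealI pole_gram_tendsto stable)
    then show "ennreal (2 * pi * q 0) \<le> (SUP \<sigma>\<in>{0<..}. ennreal (2 * pi * q \<sigma>))"
    proof (rule tendsto_upperbound)
      show "\<forall>\<^sub>F \<sigma> in at_right 0. ennreal (2 * pi * q \<sigma>) \<le> (SUP \<sigma>\<in>{0<..}. ennreal (2 * pi * q \<sigma>))"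
        using eventually_at_right_less[of 0] by eventually_elim (rule SUP_upper, simp)
    qed simp
  qed
  finally show ?thesis by (simp add: q_def)
qed

text \<open>In the Gram sum at \<sigma> = 0, the inner sum of
  \<open>cnj (r l) / (- \<nu> k - cnj (\<nu> l))\<close> over l is the conjugate of the pole sum at
  \<open>- cnj (\<nu> k)\<close>, a point of the right half-plane where the expansion of
  \<open>H\<close> holds.\<close>

lemma h2_norm_pole_residue:
  fixes \<nu> :: "'k::finite \<Rightarrow> complex" and R :: "'k \<Rightarrow> complex^'m^'p"
  assumes stable: "\<And>k. Re (\<nu> k) < 0"
    and H: "\<And>s i j. Re s > 0 \<Longrightarrow> H s $ i $ j = (\<Sum>k\<in>UNIV. R k $ i $ j / (s - \<nu> k))"
  shows "in_H2 H"
    and "complex_of_real ((h2_norm H)\<^sup>2) =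
      (\<Sum>k\<in>UNIV. \<Sum>i\<in>UNIV. \<Sum>j\<in>UNIV. R k $ i $ j * cnj (H (- cnj (\<nu> k)) $ i $ j))"
proof -
  note E = h2_energy_pole_residue[OF stable H]
  let ?g = "\<lambda>i j. pole_gram (\<lambda>k. R k $ i $ j) \<nu> 0"
  show "in_H2 H"
    by (simp add: in_H2_def E)
  have nonneg: "0 \<le> (\<Sum>i\<in>UNIV. \<Sum>j\<in>UNIV. Re (?g i j))"
    by (intro sum_nonneg pole_gram_nonneg stable) simp
  have "complex_of_real ((h2_norm H)\<^sup>2) = of_real (\<Sum>i\<in>UNIV. \<Sum>j\<in>UNIV. Re (?g i j))"
    using nonneg by (simp add: h2_norm_def E)
  also have "\<dots> = (\<Sum>i\<in>UNIV. \<Sum>j\<in>UNIV. ?g i j)"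
    by (simp add: pole_gram_eq_integral(3)[where \<nu> = \<nu> and \<sigma> = 0, OF stable])
  also have "\<dots> = (\<Sum>i\<in>UNIV. \<Sum>j\<in>UNIV. \<Sum>k\<in>UNIV. R k $ i $ j * cnj (H (- cnj (\<nu> k)) $ i $ j))"
    using stable by (simp add: H pole_gram_def sum_distrib_left)
  also have "\<dots> = (\<Sum>k\<in>UNIV. \<Sum>i\<in>UNIV. \<Sum>j\<in>UNIV. R k $ i $ j * cnj (H (- cnj (\<nu> k)) $ i $ j))"
    by (subst sum.swap[of _ UNIV "UNIV :: 'k set"], intro sum.cong refl) (rule sum.swap)
  finally show "complex_of_real ((h2_norm H)\<^sup>2) =
      (\<Sum>k\<in>UNIV. \<Sum>i\<in>UNIV. \<Sum>j\<in>UNIV. R k $ i $ j * cnj (H (- cnj (\<nu> k)) $ i $ j))" .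
qed

subsection \<open>The factors at the mirrored poles\<close>

lemma matrix_inv_cnj:
  assumes "\<not> is_eigenvalue A s"
  shows "matrix_inv (mat (cnj s) - cmat A) = map_matrix cnj (matrix_inv (mat s - cmat A))"
proof (rule matrix_inv_unique)
  let ?Y = "matrix_inv (mat s - cmat A)"
  have "mat (cnj s) - cmat A = map_matrix cnj (mat s - cmat A)"
    by (simp add: vec_eq_iff mat_def)
  then have "(mat (cnj s) - cmat A) ** map_matrix cnj ?Y = map_matrix cnj ((mat s - cmat A) ** ?Y)"
    by (simp add: vec_eq_iff matrix_matrix_mult_def)
  also have "\<dots> = mat 1"
    unfolding not_eigenvalue_inv(1)[OF assms] by (simp add: vec_eq_iff mat_def)
  finally show "(mat (cnj s) - cmat A) ** map_matrix cnj ?Y = mat 1" .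
qed

lemma cnj_mat_1: "cnj (mat 1 $ i $ j) = mat 1 $ i $ j"
  by (simp add: mat_def)

text \<open>The coefficient matrices are real. This trades the conjugated value of H at
  \<open>- cnj z\<close> for H at \<open>- z\<close>, so that no conjugation is left in the final
  formula.\<close>

lemma factors_MN_cnj:
  assumes "\<not> is_eigenvalue (closed_loop A C P) s"
  shows "factors_MN A B C P (cnj s) $ i $ j = cnj (factors_MN A B C P s $ i $ j)"
  by (cases j) (simp_all add: factors_MN_def hcat_def factor_M_def factor_N_def
      matrix_inv_cnj[OF assms] matrix_matrix_mult_def cnj_mat_1)

lemma factor_M_mult_vector: "factor_M A C P s *v x =
    x - cmat C *v (matrix_inv (mat s - cmat (closed_loop A C P)) *v (cmat (gain C P) *v x))"
  by (simp add: factor_M_def matrix_vector_mult_diff_rdistrib matrix_vector_mul_assoc matrix_mul_assoc)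

lemma factor_N_mult_vector: "factor_N A B C P s *v x =
    cmat C *v (matrix_inv (mat s - cmat (closed_loop A C P)) *v (cmat B *v x))"
  by (simp add: factor_N_def matrix_vector_mul_assoc matrix_mul_assoc)

lemma not_eigenvalue_solve:
  assumes "\<not> is_eigenvalue A s" and "s *s x - cmat A *v x = y"
  shows "matrix_inv (mat s - cmat A) *v y = x"
proof -
  have "(mat s - cmat A) *v x = y"
    using assms(2) by (simp add: matrix_vector_mult_diff_rdistrib mat_mult_vector)
  then have "matrix_inv (mat s - cmat A) *v y = (matrix_inv (mat s - cmat A) ** (mat s - cmat A)) *v x"
    by (simp add: matrix_vector_mul_assoc[symmetric])
  then show ?thesis by (simp add: not_eigenvalue_inv(2)[OF assms(1)])
qed

text \<open>N = M G in state-space form: if (sI - A) x = B u and y = C x, then (sI - A_F) x = B u +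
  F y for the closed loop A_F. Applying C times the resolvent of A_F gives y = N u + (I - M)
  y.\<close>

lemma factor_M_transfer:
  assumes "\<not> is_eigenvalue A s" and "\<not> is_eigenvalue (closed_loop A C P) s"
  shows "factor_M A C P s *v (transfer A B C s *v u) = factor_N A B C P s *v u"
proof -
  define x where "x = matrix_inv (mat s - cmat A) *v (cmat B *v u)"
  let ?R = "matrix_inv (mat s - cmat (closed_loop A C P))"
  have "(mat s - cmat A) *v x = cmat B *v u"
    by (simp add: x_def matrix_vector_mul_assoc matrix_mul_assoc not_eigenvalue_inv(1)[OF assms(1)])
  then have "s *s x - cmat (closed_loop A C P) *v x = cmat B *v u + cmat (gain C P) *v (cmat C *v x)"
    by (simp add: closed_loop_mult matrix_vector_mult_diff_rdistrib mat_mult_vector algebra_simps)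
  from not_eigenvalue_solve[OF assms(2) this]
  have "?R *v (cmat B *v u) = x - ?R *v (cmat (gain C P) *v (cmat C *v x))"
    by (simp add: matrix_vector_right_distrib eq_diff_eq)
  moreover have "transfer A B C s *v u = cmat C *v x"
    by (simp add: transfer_def x_def matrix_vector_mul_assoc matrix_mul_assoc)
  ultimately show ?thesis
    by (simp add: factor_M_mult_vector factor_N_mult_vector matrix_vector_mult_diff_distrib)
qed

section \<open>Pairing the residues with the factors at the mirrored poles\<close>

lemma sum_UNIV_sum_type:
  fixes g :: "'k::finite + 'l::finite \<Rightarrow> 'a::comm_monoid_add"
  shows "sum g UNIV = (\<Sum>a\<in>UNIV. g (Inl a)) + (\<Sum>b\<in>UNIV. g (Inr b))"
  by (simp add: sum.Plus flip: UNIV_Plus_UNIV)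

lemma hcat_mult_vcat: "hcat X Y *v vcat x y = X *v x + Y *v y"
  by (simp add: vec_eq_iff matrix_vector_mult_def hcat_def vcat_def sum_UNIV_sum_type)

text \<open>Collapses the trace pairing of a rank-one residue with a value of H to x^T Z y, the
  shape of the summands in the gap formula.\<close>

lemma sum_outer_mult:
  fixes Z :: "'a::comm_semiring_1^'m^'p"
  shows "(\<Sum>i\<in>UNIV. \<Sum>j\<in>UNIV. outer x y $ i $ j * Z $ i $ j) = scalar_product x (Z *v y)"
  by (simp add: outer_def scalar_product_def matrix_vector_mult_def sum_distrib_left mult_ac)

lemma res_f_eq:
  assumes R: "riccati_solution A B C P"
  shows "res_f C P W i = - (cmat C *v (cmat P *v column i W))"
  using R by (simp add: res_f_def gain_left_mult riccati_solution_def pos_semidef_def)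

text \<open>For v = P w_i, C v = - f_i turns the Riccati identity into (- \<mu>_i I - A_F) v = B b_i
  - F f_i, with A_F the closed loop. Solving for v and applying C gives - f_i = N b_i + M f_i -
  f_i.\<close>

lemma factors_MN_own_pole:
  assumes R: "riccati_solution A B C P" and E: "left_eigenbasis (closed_loop A C P) \<mu> W"
    and ne: "\<not> is_eigenvalue (closed_loop A C P) (- \<mu> i)"
  shows "factors_MN A B C P (- \<mu> i) *v vcat (res_f C P W i) (res_b B W i) = 0"
proof -
  define v where "v = cmat P *v column i W"
  let ?R = "matrix_inv (mat (- \<mu> i) - cmat (closed_loop A C P))"
  have "column i W v* cmat (closed_loop A C P) = \<mu> i *s column i W"
    using E by (simp add: left_eigenbasis_def)
  from riccati_left_eigenvector_solve[OF R this]
  have v: "(- \<mu> i) *s v - cmat A *v v = cmat B *v res_b B W i"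
    by (simp add: v_def res_b_def)
  have f: "cmat C *v v = - res_f C P W i"
    by (simp add: res_f_eq[OF R] v_def)
  have "- \<mu> i *s v - cmat (closed_loop A C P) *v v
      = cmat B *v res_b B W i - cmat (gain C P) *v res_f C P W i"
  proof -
    have "cmat (gain C P) *v (- res_f C P W i) = - (cmat (gain C P) *v res_f C P W i)"
      by (simp add: vec_eq_iff matrix_vector_mult_def sum_negf)
    with v show ?thesis
      by (simp add: closed_loop_mult f)
  qed
  from not_eigenvalue_solve[OF ne this]
  have "?R *v (cmat B *v res_b B W i) = v + ?R *v (cmat (gain C P) *v res_f C P W i)"
    by (simp add: matrix_vector_mult_diff_distrib algebra_simps)
  then show ?thesis
    by (simp add: factors_MN_def hcat_mult_vcat factor_M_mult_vector factor_N_mult_vector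
        matrix_vector_right_distrib f)
qed

lemma transfer_res_b:
  assumes R: "riccati_solution A B C P" and E: "left_eigenbasis (closed_loop A C P) \<mu> W"
    and ne: "\<not> is_eigenvalue A (- \<mu> i)"
  shows "transfer A B C (- \<mu> i) *v res_b B W i = - res_f C P W i"
proof -
  define v where "v = cmat P *v column i W"
  have "column i W v* cmat (closed_loop A C P) = \<mu> i *s column i W"
    using E by (simp add: left_eigenbasis_def)
  from riccati_left_eigenvector_solve[OF R this]
  have "(- \<mu> i) *s v - cmat A *v v = cmat B *v res_b B W i"
    by (simp add: v_def res_b_def)
  from not_eigenvalue_solve[OF ne this]
  have "transfer A B C (- \<mu> i) *v res_b B W i = cmat C *v v"
    by (simp add: transfer_def flip: matrix_vector_mul_assoc)
  then show ?thesis
    by (simp add: res_f_eq[OF R] v_def)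
qed

text \<open>Both f_i = - G b_i and N_h = M_h G_h are used at the same point, so M_h factors out of
  M_h f_i + N_h b_i.\<close>

lemma factors_MN_cross_pole:
  assumes R: "riccati_solution A B C P" and E: "left_eigenbasis (closed_loop A C P) \<mu> W"
    and "\<not> is_eigenvalue A (- \<mu> i)" and "\<not> is_eigenvalue Ah (- \<mu> i)"
    and "\<not> is_eigenvalue (closed_loop Ah Ch Ph) (- \<mu> i)"
  shows "factors_MN Ah Bh Ch Ph (- \<mu> i) *v vcat (res_f C P W i) (res_b B W i) =
    - (factor_M Ah Ch Ph (- \<mu> i) *v
        ((transfer A B C (- \<mu> i) - transfer Ah Bh Ch (- \<mu> i)) *v res_b B W i))"
proof -
  have "res_f C P W i = - (transfer A B C (- \<mu> i) *v res_b B W i)"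
    by (simp add: transfer_res_b[OF assms(1-3)])
  moreover have "X *v (- y) = - (X *v y)" for X :: "complex^'p^'p" and y
    by (simp add: vec_eq_iff matrix_vector_mult_def sum_negf)
  ultimately show ?thesis
    by (simp add: factors_MN_def hcat_mult_vcat matrix_vector_mult_diff_rdistrib
        matrix_vector_mult_diff_distrib factor_M_transfer[OF assms(4,5)])
qed

theorem theorem1:
  fixes A :: "real^'n^'n" and B :: "real^'m^'n" and C :: "real^'n^'p" and P :: "real^'n^'n"
    and Ah :: "real^'r^'r" and Bh :: "real^'m^'r" and Ch :: "real^'r^'p" and Ph :: "real^'r^'r"
    and \<mu> :: "'n \<Rightarrow> complex" and W :: "complex^'n^'n"
    and \<mu>h :: "'r \<Rightarrow> complex" and Wh :: "complex^'r^'r"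
  assumes "stabilizable A B" and "detectable A C"
    and "stabilizable Ah Bh" and "detectable Ah Ch"
    and "riccati_solution A B C P" and "riccati_solution Ah Bh Ch Ph"
    and "left_eigenbasis (closed_loop A C P) \<mu> W"
    and "left_eigenbasis (closed_loop Ah Ch Ph) \<mu>h Wh"
    and "\<And>i. \<not> is_eigenvalue A (- \<mu> i)" and "\<And>i. \<not> is_eigenvalue Ah (- \<mu> i)"
    and "\<And>j. \<not> is_eigenvalue A (- \<mu>h j)" and "\<And>j. \<not> is_eigenvalue Ah (- \<mu>h j)"
  shows "in_H2 (\<lambda>s. factors_MN A B C P s - factors_MN Ah Bh Ch Ph s) \<and>
    complex_of_real ((h2_gap A B C P Ah Bh Ch Ph)\<^sup>2) =
      (\<Sum>i\<in>UNIV. scalar_product (res_c C W i)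
         (factor_M Ah Ch Ph (- \<mu> i) *v
           ((transfer A B C (- \<mu> i) - transfer Ah Bh Ch (- \<mu> i)) *v res_b B W i))) +
      (\<Sum>j\<in>UNIV. scalar_product (res_c Ch Wh j)
         (factor_M A C P (- \<mu>h j) *v
           ((transfer Ah Bh Ch (- \<mu>h j) - transfer A B C (- \<mu>h j)) *v res_b Bh Wh j)))"
proof -
  note R = assms(5,6) and E = assms(7,8)
  define H where "H s = factors_MN A B C P s - factors_MN Ah Bh Ch Ph s" for s
  define d where "d i = vcat (res_f C P W i) (res_b B W i)" for i
  define dh where "dh j = vcat (res_f Ch Ph Wh j) (res_b Bh Wh j)" for j
  \<comment> \<open>The poles of both systems are indexed together by the sum type; coinciding poles
    occur under several indices. Residues of the second system carry a minus sign because H is a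
    difference.\<close>
  define \<nu> where "\<nu> k = (case k of Inl i \<Rightarrow> \<mu> i | Inr j \<Rightarrow> \<mu>h j)" for k
  define X where "X k = (case k of Inl i \<Rightarrow> outer (res_c C W i) (d i)
      | Inr j \<Rightarrow> - outer (res_c Ch Wh j) (dh j))" for k
  have \<mu>: "Re (\<mu> i) < 0" for i
  proof (rule closed_loop_stable[OF assms(1,5) _ left_eigenbasis_column_nonzero[OF E(1)]])
    show "column i W v* cmat (closed_loop A C P) = \<mu> i *s column i W"
      using E(1) by (simp add: left_eigenbasis_def)
  qed
  have \<mu>h: "Re (\<mu>h j) < 0" for j
  proof (rule closed_loop_stable[OF assms(3,6) _ left_eigenbasis_column_nonzero[OF E(2)]])
    show "column j Wh v* cmat (closed_loop Ah Ch Ph) = \<mu>h j *s column j Wh"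
      using E(2) by (simp add: left_eigenbasis_def)
  qed
  have \<nu>: "Re (\<nu> k) < 0" for k
    using \<mu> \<mu>h by (cases k) (simp_all add: \<nu>_def)
  have ne: "\<not> is_eigenvalue (closed_loop A C P) s" "\<not> is_eigenvalue (closed_loop Ah Ch Ph) s"
    if "Re s > 0" for s
    using left_eigenbasis_eigenvalue[OF E(1)] left_eigenbasis_eigenvalue[OF E(2)] \<mu> \<mu>h that
    by (metis less_asym)+
  \<comment> \<open>The constant terms [I, 0] cancel, which leaves a pure sum of simple
    poles.\<close>
  have pr: "H s $ a $ b = (\<Sum>k\<in>UNIV. X k $ a $ b / (s - \<nu> k))" if "Re s > 0" for s a b
  proof -
    have "s \<noteq> \<mu> i" "s \<noteq> \<mu>h j" for i j
      using that \<mu>[of i] \<mu>h[of j] by auto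
    from factors_MN_pole_residue[OF E(1) this(1), of B] factors_MN_pole_residue[OF E(2) this(2), of Bh]
    show ?thesis
      by (simp add: H_def sum_UNIV_sum_type \<nu>_def X_def d_def dh_def sum_negf)
  qed
  have conj: "cnj (H (- cnj z) $ a $ b) = H (- z) $ a $ b" if "Re z < 0" for z a b
  proof -
    have "Re (- z) > 0" using that by simp
    from factors_MN_cnj[OF ne(1)[OF this], of B a b] factors_MN_cnj[OF ne(2)[OF this], of Bh a b]
    show ?thesis by (simp add: H_def)
  qed
  have own: "factors_MN A B C P (- \<mu> i) *v d i = 0"
    "factors_MN Ah Bh Ch Ph (- \<mu>h j) *v dh j = 0" for i j
    using factors_MN_own_pole[OF R(1) E(1)] factors_MN_own_pole[OF R(2) E(2)] ne \<mu>[of i] \<mu>h[of j]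
    by (simp_all add: d_def dh_def)
  have cross: "factors_MN Ah Bh Ch Ph (- \<mu> i) *v d i = - (factor_M Ah Ch Ph (- \<mu> i) *v
        ((transfer A B C (- \<mu> i) - transfer Ah Bh Ch (- \<mu> i)) *v res_b B W i))"
    "factors_MN A B C P (- \<mu>h j) *v dh j = - (factor_M A C P (- \<mu>h j) *v
        ((transfer Ah Bh Ch (- \<mu>h j) - transfer A B C (- \<mu>h j)) *v res_b Bh Wh j))" for i j
    using \<mu>[of i] \<mu>h[of j] unfolding d_def dh_def
    by (intro factors_MN_cross_pole R E assms(9-12) ne; simp)+
  note h2 = h2_norm_pole_residue[of \<nu> H X, OF \<nu> pr]
  have "complex_of_real ((h2_norm H)\<^sup>2) =
      (\<Sum>k\<in>UNIV. \<Sum>a\<in>UNIV. \<Sum>b\<in>UNIV. X k $ a $ b * H (- \<nu> k) $ a $ b)"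
    using h2(2) by (simp add: conj \<nu>)
  also have "\<dots> = (\<Sum>i\<in>UNIV. scalar_product (res_c C W i) (H (- \<mu> i) *v d i))
      + (\<Sum>j\<in>UNIV. - scalar_product (res_c Ch Wh j) (H (- \<mu>h j) *v dh j))"
    by (simp add: sum_UNIV_sum_type[where 'k = 'n and 'l = 'r] X_def \<nu>_def sum_negf flip: sum_outer_mult)
  \<comment> \<open>At each mirrored pole the system's own factor drops out. In the first sum the
    minus in H cancels the one in \<open>cross\<close>; in the second, the minus of the residue
    does.\<close>
  also have "\<dots> = (\<Sum>i\<in>UNIV. scalar_product (res_c C W i)
         (factor_M Ah Ch Ph (- \<mu> i) *v
           ((transfer A B C (- \<mu> i) - transfer Ah Bh Ch (- \<mu> i)) *v res_b B W i))) +
      (\<Sum>j\<in>UNIV. scalar_product (res_c Ch Wh j)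
         (factor_M A C P (- \<mu>h j) *v
           ((transfer Ah Bh Ch (- \<mu>h j) - transfer A B C (- \<mu>h j)) *v res_b Bh Wh j)))"
    by (simp add: H_def matrix_vector_mult_diff_rdistrib[of "factors_MN _ _ _ _ _"] own cross
        scalar_product_def sum_negf)
  finally show ?thesis
    using h2(1) by (simp add: h2_gap_def H_def[abs_def])
qed

end
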